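(* For any positive integer $k$, we have $N'_k(3) \leq N_k(3) \leq 11k-2$; in particular every tournament $T$ on $n \ge 11k-2$ vertices satisfies $\mathrm{sinv}'_k(T)\le \mathrm{sinv}_k(T) \leq 3$.
   Context: A tournament is an orientation of a complete graph. For a digraph $D$ and $X \subseteq V(D)$, inverting $X$ means reversing the direction of every arc of $D$ with both endvertices in $X$. A digraph $D$ is $k$-arc-strong if for every partition $(V_1,V_2)$ of $V(D)$ into nonempty sets there are at least $k$ arcs from $V_1$ to $V_2$; it is $k$-strong if $|V(D)|\ge k+1$ and $D-S$ is strongly connected for every $S\subseteq V(D)$ with $|S|<k$. $\mathrm{sinv}'_k(D)$ (resp. $\mathrm{sinv}_k(D)$) is the minimum number of sets whose successive inversion transforms $D$ into a $k$-arc-strong (resp. $k$-strong) digraph. For $n \ge 2k+1$, $m_k(n) = \max\{\mathrm{sinv}_k(T) : T \text{ tournament of order } n\}$ and $m'_k(n) = \max\{\mathrm{sinv}'_k(T) : T \text{ tournament of order } n\}$. For positive integers $k,i$, $N_k(i)$ (resp. $N'_k(i)$) is the smallest integer such that $m_k(n) \leq i$ (resp. $m'_k(n)\le i$) for all $n \geq N_k(i)$ (resp. $n\ge N'_k(i)$). *)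

theory Defs
  imports Main "HOL-Library.Extended_Nat"
begin

text \<open>A digraph is a finite vertex set V together with an arc relation A.\<close>

definition tournament :: "'a set \<Rightarrow> ('a \<times> 'a) set \<Rightarrow> bool" where
  "tournament V A \<longleftrightarrow> finite V \<and> A \<subseteq> V \<times> V \<and> (\<forall>v. (v, v) \<notin> A) \<and>
     (\<forall>u\<in>V. \<forall>v\<in>V. u \<noteq> v \<longrightarrow> ((u, v) \<in> A \<longleftrightarrow> (v, u) \<notin> A))"

text \<open>Inverting X: reverse every arc with both ends in X.\<close>
definition invert :: "('a \<times> 'a) set \<Rightarrow> 'a set \<Rightarrow> ('a \<times> 'a) set" where
  "invert A X = {(u, v). (u, v) \<in> A \<and> \<not> (u \<in> X \<and> v \<in> X)}
              \<union> {(v, u) | u v. (u, v) \<in> A \<and> u \<in> X \<and> v \<in> X}"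

definition invert_seq :: "('a \<times> 'a) set \<Rightarrow> 'a set list \<Rightarrow> ('a \<times> 'a) set" where
  "invert_seq A Xs = foldl invert A Xs"

definition arc_strong :: "'a set \<Rightarrow> ('a \<times> 'a) set \<Rightarrow> nat \<Rightarrow> bool" where
  "arc_strong V A k \<longleftrightarrow> (\<forall>V1 V2. V1 \<noteq> {} \<and> V2 \<noteq> {} \<and> V1 \<inter> V2 = {} \<and> V1 \<union> V2 = V \<longrightarrow>
      card {(u, v). (u, v) \<in> A \<and> u \<in> V1 \<and> v \<in> V2} \<ge> k)"

definition strongly_connected :: "'a set \<Rightarrow> ('a \<times> 'a) set \<Rightarrow> bool" where
  "strongly_connected V A \<longleftrightarrow> (\<forall>u\<in>V. \<forall>v\<in>V. (u, v) \<in> (A \<inter> (V \<times> V))\<^sup>*)"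

definition vertex_strong :: "'a set \<Rightarrow> ('a \<times> 'a) set \<Rightarrow> nat \<Rightarrow> bool" where
  "vertex_strong V A k \<longleftrightarrow> card V \<ge> k + 1 \<and>
     (\<forall>S. S \<subseteq> V \<and> card S < k \<longrightarrow> strongly_connected (V - S) (A \<inter> ((V - S) \<times> (V - S))))"

text \<open>Minimum number of inversions (\<infinity> if impossible).\<close>
definition sinv :: "'a set \<Rightarrow> ('a \<times> 'a) set \<Rightarrow> nat \<Rightarrow> enat" where
  "sinv V A k = Inf {enat (length Xs) | Xs. set Xs \<subseteq> Pow V \<and> vertex_strong V (invert_seq A Xs) k}"

definition sinv' :: "'a set \<Rightarrow> ('a \<times> 'a) set \<Rightarrow> nat \<Rightarrow> enat" where
  "sinv' V A k = Inf {enat (length Xs) | Xs. set Xs \<subseteq> Pow V \<and> arc_strong V (invert_seq A Xs) k}"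

text \<open>Tournaments of order n are taken on vertex set {0..<n}.\<close>
definition m_k :: "nat \<Rightarrow> nat \<Rightarrow> enat" where
  "m_k k n = Sup {sinv {0..<n} A k | A. tournament {0..<n::nat} A}"

definition m'_k :: "nat \<Rightarrow> nat \<Rightarrow> enat" where
  "m'_k k n = Sup {sinv' {0..<n} A k | A. tournament {0..<n::nat} A}"

definition N_k :: "nat \<Rightarrow> nat \<Rightarrow> nat" where
  "N_k k i = (LEAST N. \<forall>n\<ge>N. n \<ge> 2 * k + 1 \<longrightarrow> m_k k n \<le> enat i)"

definition N'_k :: "nat \<Rightarrow> nat \<Rightarrow> nat" where
  "N'_k k i = (LEAST N. \<forall>n\<ge>N. n \<ge> 2 * k + 1 \<longrightarrow> m'_k k n \<le> enat i)"

end

theory Submission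
  imports Defs "HOL-Library.Multiset"
begin

text \<open>
  Two inversions already suffice.  Take a median order of the tournament, that is, one with as few
  backward arcs as possible, and let \<open>A\<close> and \<open>B\<close> be its first and last \<open>2k - 1\<close> vertices and \<open>Z\<close> the
  remaining ones.  For \<open>A' \<subseteq> A\<close> and \<open>B' \<subseteq> B\<close>, inverting \<open>A' \<union> B\<close> and then \<open>A \<union> B'\<close> reverses, apart
  from arcs inside \<open>A\<close> or inside \<open>B\<close>, exactly the arcs between \<open>a \<in> A\<close> and \<open>b \<in> B\<close> with one of
  \<open>a \<in> A'\<close>, \<open>b \<in> B'\<close>.  Choosing \<open>A'\<close>, \<open>B'\<close> such that the number of arcs from \<open>B\<close> to \<open>A\<close> becomes
  maximal, every \<open>b\<close> gets at least \<open>k\<close> out-neighbours in \<open>A\<close> and every \<open>a\<close> at least \<open>k\<close>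
  in-neighbours in \<open>B\<close>.

  Suppose that after deleting a set \<open>S\<close> of fewer than \<open>k\<close> vertices the rest splits into \<open>P\<close> and \<open>Q\<close>
  with all arcs going from \<open>P\<close> to \<open>Q\<close>.  In a median order each vertex dominates at least half of
  every interval that follows it, so the last vertex of \<open>Q\<close> lies in \<open>B\<close>; hence \<open>Q\<close> meets \<open>A\<close> in at
  least \<open>k - |S \<inter> A|\<close> vertices, and the last of these forces \<open>Q \<union> S\<close> to fill about half of every
  prefix of \<open>Z\<close>.  Symmetrically \<open>P \<union> S\<close> fills about half of every suffix of \<open>Z\<close>.  This forces more
  than \<open>|S \<inter> Z|\<^sup>2\<close> pairs in which a vertex of \<open>Q\<close> precedes one of \<open>P\<close>, all of them backward arcs.
  Rearranging \<open>Z\<close> removes these backward arcs and creates new ones only at \<open>S\<close>, which shows that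
  there are at most \<open>|S \<inter> Z|\<^sup>2\<close> of them, a contradiction.
\<close>

section \<open>Counting pairs in a list\<close>

definition count_in :: "'a set \<Rightarrow> 'a list \<Rightarrow> nat" where
  "count_in X xs = length (filter (\<lambda>x. x \<in> X) xs)"

definition count_cross :: "('a \<times> 'a) set \<Rightarrow> 'a list \<Rightarrow> 'a list \<Rightarrow> nat" where
  "count_cross r xs ys = (\<Sum>x\<leftarrow>xs. count_in (r `` {x}) ys)"

fun count_pairs :: "('a \<times> 'a) set \<Rightarrow> 'a list \<Rightarrow> nat" where
  "count_pairs r [] = 0"
| "count_pairs r (x # xs) = count_in (r `` {x}) xs + count_pairs r xs"

lemma count_in_simps [simp]:
  "count_in X [] = 0"
  "count_in X (x # xs) = of_bool (x \<in> X) + count_in X xs"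
  "count_in X (xs @ ys) = count_in X xs + count_in X ys"
  "count_in X (rev xs) = count_in X xs"
  "count_in {} xs = 0"
  by (simp_all add: count_in_def flip: rev_filter)

lemma count_in_mono: "X \<inter> set xs \<subseteq> Y \<Longrightarrow> count_in X xs \<le> count_in Y xs"
  by (induction xs) auto

lemma count_in_eq_0: "X \<inter> set xs = {} \<Longrightarrow> count_in X xs = 0"
  by (induction xs) auto

lemma count_in_le_length: "count_in X xs \<le> length xs"
  by (simp add: count_in_def)

lemma count_in_Un_le: "count_in (X \<union> Y) xs \<le> count_in X xs + count_in Y xs"
  by (induction xs) auto

lemma length_le_count_in_Un:
  assumes "set xs \<subseteq> X \<union> Y"
  shows "length xs \<le> count_in X xs + count_in Y xs"
  using assms by (induction xs) auto

lemma count_in_eq_card: "distinct xs \<Longrightarrow> count_in X xs = card (X \<inter> set xs)"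
  by (simp add: count_in_def Int_def conj_commute flip: distinct_card)

lemma count_in_mset_cong:
  assumes "mset xs = mset ys"
  shows "count_in X xs = count_in X ys"
  unfolding count_in_def using assms by (metis mset_filter size_mset)

lemma count_cross_simps [simp]:
  "count_cross r [] ys = 0"
  "count_cross r (x # xs) ys = count_in (r `` {x}) ys + count_cross r xs ys"
  "count_cross r xs [] = 0"
  by (simp_all add: count_cross_def)

lemma count_cross_append_left [simp]:
  "count_cross r (xs @ xs') ys = count_cross r xs ys + count_cross r xs' ys"
  by (simp add: count_cross_def)

lemma count_cross_append_right [simp]:
  "count_cross r xs (ys @ ys') = count_cross r xs ys + count_cross r xs ys'"
  by (induction xs) auto

lemma count_cross_Cons_right [simp]:
  "count_cross r xs (y # ys) = count_in (r\<inverse> `` {y}) xs + count_cross r xs ys"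
  by (induction xs) auto

lemma count_cross_mset_cong:
  assumes "mset xs = mset xs'" "mset ys = mset ys'"
  shows "count_cross r xs ys = count_cross r xs' ys'"
proof -
  have "count_cross r us ys = (\<Sum>x\<in>#mset us. count_in (r `` {x}) ys)" for us
    by (induction us) simp_all
  then have "count_cross r xs ys = count_cross r xs' ys"
    using assms(1) by simp
  also have "\<dots> = count_cross r xs' ys'"
    using count_in_mset_cong[OF assms(2)] by (simp add: count_cross_def)
  finally show ?thesis .
qed

lemma Times_Image_singleton: "(X \<times> Y) `` {x} = (if x \<in> X then Y else {})"
  by auto

lemma count_cross_Times: "count_cross (X \<times> Y) xs ys = count_in X xs * count_in Y ys"
  by (induction xs) (auto simp: Times_Image_singleton)

lemma count_cross_eq_0:
  assumes "r \<inter> set xs \<times> set ys = {}"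
  shows "count_cross r xs ys = 0"
  using assms
proof (induction xs)
  case (Cons x xs)
  have "count_in (r `` {x}) ys = 0"
    using Cons.prems by (intro count_in_eq_0) auto
  with Cons show ?case by auto
qed simp

lemma count_pairs_append:
  "count_pairs r (xs @ ys) = count_pairs r xs + count_pairs r ys + count_cross r xs ys"
  by (induction xs) auto

lemma count_pairs_rev: "count_pairs r (rev xs) = count_pairs (r\<inverse>) xs"
  by (induction xs) (auto simp: count_pairs_append)

lemma count_pairs_mono:
  assumes "r \<inter> set xs \<times> set xs \<subseteq> s"
  shows "count_pairs r xs \<le> count_pairs s xs"
  using assms
proof (induction xs)
  case (Cons x xs)
  have "count_in (r `` {x}) xs \<le> count_in (s `` {x}) xs"
    using Cons.prems by (intro count_in_mono) auto
  moreover have "count_pairs r xs \<le> count_pairs s xs"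
    using Cons by auto
  ultimately show ?case by simp
qed simp

lemma count_pairs_Times_le: "count_pairs (X \<times> Y) xs \<le> count_in X xs * count_in Y xs"
  by (induction xs) (auto simp: Times_Image_singleton)

lemma count_pairs_move_to_end:
  "count_pairs r (filter (\<lambda>x. x \<notin> M) xs @ filter (\<lambda>x. x \<in> M) xs) + count_pairs (r \<inter> M \<times> - M) xs
    = count_pairs r xs + count_pairs (r\<inverse> \<inter> M \<times> - M) xs"
proof (induction xs)
  case (Cons x xs)
  let ?N = "filter (\<lambda>x. x \<notin> M) xs" and ?Y = "filter (\<lambda>x. x \<in> M) xs"
  have split: "count_in X xs = count_in X ?N + count_in X ?Y" for X
    using count_in_mset_cong[of xs "?N @ ?Y" X] by simp
  show ?case
  proof (cases "x \<in> M")
    case False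
    then have "(s \<inter> M \<times> - M) `` {x} = {}" for s
      by auto
    then show ?thesis
      using False Cons split[of "r `` {x}"] by simp
  next
    case True
    have "count_in ((s \<inter> M \<times> - M) `` {x}) xs = count_in (s `` {x}) ?N" for s
      unfolding count_in_def filter_filter using True
      by (intro arg_cong[where f = length] filter_cong) auto
    then show ?thesis
      using True Cons split[of "r `` {x}"] by (simp add: count_pairs_append)
  qed
qed simp

lemma ex_equal_split:
  assumes "P \<inter> Q = {}"
  obtains L R where "xs = L @ R" "count_in Q L = count_in P R"
proof -
  define f where "f i = int (count_in Q (take i xs)) - int (count_in P (drop i xs))" for i
  have "\<bar>f (i + 1) - f i\<bar> \<le> 1" if "i < length xs" for i
  proof -
    have "take (i + 1) xs = take i xs @ [xs ! i]" "drop i xs = xs ! i # drop (i + 1) xs"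
      using that by (simp_all add: take_Suc_conv_app_nth Cons_nth_drop_Suc)
    then show ?thesis
      unfolding f_def using assms by auto
  qed
  then obtain i where "f i = 0"
    using nat0_intermed_int_val[of "length xs" f 0] by (auto simp: f_def)
  then show thesis
    using that[of "take i xs" "drop i xs"] by (simp add: f_def)
qed

lemma count_pairs_Times_ge:
  assumes "P \<inter> Q = {}"
    and "\<And>ys zs. xs = ys @ zs \<Longrightarrow> count_in P ys \<le> count_in Q ys + w"
  shows "(count_in P xs - w) * (count_in P xs - w + 1) \<le> 2 * count_pairs (Q \<times> P) xs"
  using assms(2)
proof (induction xs rule: rev_induct)
  case (snoc x xs)
  have IH: "(count_in P xs - w) * (count_in P xs - w + 1) \<le> 2 * count_pairs (Q \<times> P) xs"
    using snoc.IH snoc.prems[of _ "_ @ [x]"] by simp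
  have pairs: "count_pairs (Q \<times> P) (xs @ [x])
      = count_pairs (Q \<times> P) xs + of_bool (x \<in> P) * count_in Q xs"
    by (simp add: count_pairs_append converse_Times Times_Image_singleton)
  show ?case
  proof (cases "x \<in> P \<and> w \<le> count_in P xs")
    case True
    then obtain m where m: "count_in P xs = w + m"
      using le_Suc_ex by blast
    moreover have "x \<notin> Q"
      using True assms(1) by auto
    then have "m + 1 \<le> count_in Q xs"
      using snoc.prems[of "xs @ [x]" "[]"] True m by simp
    ultimately show ?thesis
      using IH True unfolding pairs by (simp add: algebra_simps)
  next
    case False
    then show ?thesis
      using IH unfolding pairs by auto
  qed
qed simp


section \<open>Median orders\<close>

abbreviation backward_arcs :: "('a \<times> 'a) set \<Rightarrow> 'a list \<Rightarrow> nat" where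
  "backward_arcs T \<equiv> count_pairs (T\<inverse>)"

definition median_order :: "('a \<times> 'a) set \<Rightarrow> 'a list \<Rightarrow> bool" where
  "median_order T xs \<longleftrightarrow>
    (\<forall>ys. mset ys = mset xs \<longrightarrow> backward_arcs T xs \<le> backward_arcs T ys)"

lemma median_orderD:
  "median_order T xs \<Longrightarrow> mset ys = mset xs \<Longrightarrow> backward_arcs T xs \<le> backward_arcs T ys"
  by (simp add: median_order_def)

lemma ex_median_order:
  assumes "finite V"
  obtains xs where "set xs = V" "distinct xs" "median_order T xs"
proof -
  obtain zs where zs: "set zs = V" "distinct zs"
    using assms finite_distinct_list by blast
  obtain xs where xs: "mset xs = mset zs"
    and min: "\<And>ys. mset ys = mset zs \<Longrightarrow> backward_arcs T xs \<le> backward_arcs T ys"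
    using ex_has_least_nat[of "\<lambda>xs. mset xs = mset zs" zs "backward_arcs T"] by blast
  show thesis
  proof
    show "set xs = V" using xs zs(1) mset_eq_setD by blast
    show "distinct xs" using xs zs(2) mset_eq_imp_distinct_iff by blast
    show "median_order T xs" using xs min by (simp add: median_order_def)
  qed
qed

lemma median_order_rev:
  assumes "median_order T xs"
  shows "median_order (T\<inverse>) (rev xs)"
  unfolding median_order_def
proof (intro allI impI)
  fix ys
  assume "mset ys = mset (rev xs)"
  then have "backward_arcs T xs \<le> backward_arcs T (rev ys)"
    using assms by (intro median_orderD) simp_all
  then show "backward_arcs (T\<inverse>) (rev xs) \<le> backward_arcs (T\<inverse>) ys"
    by (simp add: count_pairs_rev)
qed

lemma median_order_infix:
  assumes "median_order T (xs @ ys @ zs)"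
  shows "median_order T ys"
  unfolding median_order_def
proof (intro allI impI)
  fix ys'
  assume m: "mset ys' = mset ys"
  have "backward_arcs T (xs @ ys @ zs) \<le> backward_arcs T (xs @ ys' @ zs)"
    using assms by (rule median_orderD) (simp add: m)
  moreover have "count_cross (T\<inverse>) ys zs = count_cross (T\<inverse>) ys' zs"
    "count_cross (T\<inverse>) xs ys = count_cross (T\<inverse>) xs ys'"
    using m by (auto intro: count_cross_mset_cong)
  ultimately show "backward_arcs T ys \<le> backward_arcs T ys'"
    by (simp add: count_pairs_append)
qed

lemma median_order_in_le_out:
  assumes "median_order T (xs @ x # ys @ zs)"
  shows "count_in (T\<inverse> `` {x}) ys \<le> count_in (T `` {x}) ys"
proof -
  have "median_order T (x # ys)"
    using median_order_infix[of T xs "x # ys" zs] assms by simp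
  then have "backward_arcs T (x # ys) \<le> backward_arcs T (ys @ [x])"
    by (rule median_orderD) simp
  then show ?thesis
    by (simp add: count_pairs_append)
qed

lemma median_order_backward_le_forward:
  assumes "median_order T xs"
  shows "count_pairs (T\<inverse> \<inter> M \<times> - M) xs \<le> count_pairs (T \<inter> M \<times> - M) xs"
proof -
  have "backward_arcs T xs
      \<le> backward_arcs T (filter (\<lambda>x. x \<notin> M) xs @ filter (\<lambda>x. x \<in> M) xs)"
    using assms by (rule median_orderD) simp
  then show ?thesis
    using count_pairs_move_to_end[of "T\<inverse>" M xs] by simp
qed

text \<open>Moving \<open>L \<inter> Q\<close> and \<open>R - P\<close> to the end turns no forward arc between \<open>P\<close> and \<open>Q\<close> backward.\<close>

lemma median_order_count_pairs_le:
  assumes med: "median_order T (L @ R)" and dist: "distinct (L @ R)"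
    and cover: "set (L @ R) \<subseteq> P \<union> Q \<union> S" and disj: "P \<inter> Q = {}"
    and dom: "(P \<inter> set (L @ R)) \<times> (Q \<inter> set (L @ R)) \<subseteq> T - T\<inverse>"
  shows "count_pairs (Q \<times> P) (L @ R) \<le> count_pairs (Q \<times> S) L + count_pairs (S \<times> P) R"
proof -
  define M where "M = (Q \<inter> set L) \<union> (set R - P)"
  let ?F = "T \<inter> M \<times> - M"
  have "count_pairs (Q \<times> P) (L @ R) \<le> count_pairs (T\<inverse> \<inter> M \<times> - M) (L @ R)"
    using dom disj by (intro count_pairs_mono) (auto simp: M_def)
  also have "\<dots> \<le> count_pairs ?F (L @ R)"
    using med by (rule median_order_backward_le_forward)
  also have "\<dots> = count_pairs ?F L + count_pairs ?F R + count_cross ?F L R"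
    by (rule count_pairs_append)
  also have "count_cross ?F L R = 0"
    using dom dist by (intro count_cross_eq_0) (auto simp: M_def)
  also have "count_pairs ?F L \<le> count_pairs (Q \<times> S) L"
    using dom dist cover by (intro count_pairs_mono) (auto simp: M_def)
  also have "count_pairs ?F R \<le> count_pairs (S \<times> P) R"
    using dom dist cover by (intro count_pairs_mono) (auto simp: M_def)
  finally show ?thesis by simp
qed

lemma median_order_count_pairs_le_square:
  assumes med: "median_order T xs" and dist: "distinct xs"
    and cover: "set xs \<subseteq> P \<union> Q \<union> S" and disj: "P \<inter> Q = {}"
    and dom: "(P \<inter> set xs) \<times> (Q \<inter> set xs) \<subseteq> T - T\<inverse>"
  shows "count_pairs (Q \<times> P) xs \<le> count_in S xs * count_in S xs"
proof -
  obtain L R where xs: "xs = L @ R" and split: "count_in Q L = count_in P R"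
    using ex_equal_split[OF disj] .
  define \<mu> where "\<mu> = count_in Q L"
  have "count_pairs (Q \<times> P) xs \<le> count_pairs (Q \<times> S) L + count_pairs (S \<times> P) R"
    using assms unfolding xs by (intro median_order_count_pairs_le)
  also have "\<dots> \<le> count_in Q L * count_in S L + count_in S R * count_in P R"
    by (intro add_mono count_pairs_Times_le)
  also have "\<dots> = \<mu> * count_in S xs"
    by (simp add: xs \<mu>_def split algebra_simps)
  finally have upper: "count_pairs (Q \<times> P) xs \<le> \<mu> * count_in S xs" .
  have "\<mu> * \<mu> \<le> count_pairs (Q \<times> P) xs"
    by (simp add: xs count_pairs_append count_cross_Times \<mu>_def split)
  with upper have "\<mu> * \<mu> \<le> \<mu> * count_in S xs"
    by linarith
  then have "\<mu> * count_in S xs \<le> count_in S xs * count_in S xs"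
    by auto
  with upper show ?thesis
    by linarith
qed

text \<open>Adding the hypotheses on the two parts of a split shows that \<open>P\<close> exceeds \<open>Q\<close> on each prefix
  by at most \<open>w\<close>.\<close>

lemma median_order_length_le:
  assumes med: "median_order T xs" and dist: "distinct xs"
    and cover: "set xs \<subseteq> P \<union> Q \<union> S" and disj: "P \<inter> Q = {}"
    and dom: "(P \<inter> set xs) \<times> (Q \<inter> set xs) \<subseteq> T - T\<inverse>"
    and prefix: "\<And>ys zs. xs = ys @ zs \<Longrightarrow> count_in P ys \<le> count_in Q ys + count_in S ys + c"
    and suffix: "\<And>ys zs. xs = ys @ zs \<Longrightarrow> count_in Q zs \<le> count_in P zs + count_in S zs + d"
  shows "length xs \<le> 5 * count_in S xs + c + d"
proof (rule ccontr)
  define s where "s = count_in S xs"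
  define w where "w = (c + d + s + count_in P xs - count_in Q xs) div 2"
  define m where "m = count_in P xs - w"
  assume "\<not> length xs \<le> 5 * count_in S xs + c + d"
  moreover have "length xs \<le> count_in P xs + count_in Q xs + s"
    unfolding s_def using length_le_count_in_Un[OF cover] count_in_Un_le[of P Q xs] by linarith
  moreover have "count_in Q xs \<le> count_in P xs + s + d"
    using suffix[of "[]"] by (simp add: s_def)
  ultimately have "3 * s + 1 \<le> 2 * m"
    unfolding m_def w_def s_def by linarith
  then have "(3 * s + 1) * (3 * s + 1) \<le> (2 * m) * (2 * m)"
    by (intro mult_mono) simp_all
  moreover have "m * (m + 1) \<le> 2 * count_pairs (Q \<times> P) xs"
    unfolding m_def
  proof (rule count_pairs_Times_ge[OF disj])
    fix ys zs
    assume xs: "xs = ys @ zs"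
    then show "count_in P ys \<le> count_in Q ys + w"
      using prefix[OF xs] suffix[OF xs] unfolding w_def s_def by simp
  qed
  moreover have "count_pairs (Q \<times> P) xs \<le> s * s"
    unfolding s_def using med dist cover disj dom by (rule median_order_count_pairs_le_square)
  ultimately show False
    using \<open>3 * s + 1 \<le> 2 * m\<close> by (simp add: algebra_simps)
qed


section \<open>Balancing a bipartite relation by switching\<close>

lemma half_related_if_complementing_row_not_better:
  assumes fin: "finite A" "finite B" and a: "a \<in> A"
    and le: "(\<Sum>x\<in>A. card {y \<in> B. N x y \<noteq> (x = a)}) \<le> (\<Sum>x\<in>A. card {y \<in> B. N x y})"
  shows "card B \<le> 2 * card {y \<in> B. N a y}"
proof -
  have "(\<Sum>x\<in>A - {a}. card {y \<in> B. N x y \<noteq> (x = a)}) = (\<Sum>x\<in>A - {a}. card {y \<in> B. N x y})"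
    by (intro sum.cong) auto
  then have "card {y \<in> B. \<not> N a y} \<le> card {y \<in> B. N a y}"
    using le by (simp add: sum.remove[OF fin(1) a])
  moreover have "card B = card {y \<in> B. N a y} + card {y \<in> B. \<not> N a y}"
    using card_Int_Diff[OF fin(2), of "{y. N a y}"] by (simp add: Int_def set_diff_eq)
  ultimately show ?thesis
    by linarith
qed

definition switched :: "('a \<Rightarrow> 'b \<Rightarrow> bool) \<Rightarrow> 'a set \<Rightarrow> 'b set \<Rightarrow> 'a \<Rightarrow> 'b \<Rightarrow> bool" where
  "switched M X Y a b \<longleftrightarrow> M a b \<noteq> ((a \<in> X) \<noteq> (b \<in> Y))"

lemma ex_balanced_switching:
  fixes M :: "'a \<Rightarrow> 'b \<Rightarrow> bool"
  assumes fin: "finite A" "finite B"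
  obtains X Y where "X \<subseteq> A" "Y \<subseteq> B"
    "\<And>a. a \<in> A \<Longrightarrow> card B \<le> 2 * card {b \<in> B. switched M X Y a b}"
    "\<And>b. b \<in> B \<Longrightarrow> card A \<le> 2 * card {a \<in> A. switched M X Y a b}"
proof -
  define \<Phi> where "\<Phi> = (\<lambda>(X, Y). \<Sum>a\<in>A. card {b \<in> B. switched M X Y a b})"
  let ?S = "Pow A \<times> Pow B"
  have \<Phi>_columns: "\<Phi> (X, Y) = (\<Sum>b\<in>B. card {a \<in> A. switched M X Y a b})" for X Y
    unfolding \<Phi>_def prod.case using fin by (intro sum_multicount_gen) auto
  have S: "finite ?S" "?S \<noteq> {}"
    using fin by auto
  then obtain Z where "Z \<in> ?S" "(MAX Z\<in>?S. \<Phi> Z) = \<Phi> Z"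
    by (rule obtains_MAX[where f = \<Phi>])
  then obtain X Y where XY: "X \<subseteq> A" "Y \<subseteq> B" and eq: "(MAX Z\<in>?S. \<Phi> Z) = \<Phi> (X, Y)"
    by blast
  have max: "\<Phi> Z \<le> \<Phi> (X, Y)" if "Z \<in> ?S" for Z
    unfolding eq[symmetric] using S(1) that by (intro Max_ge) auto
  show thesis
  proof (rule that[OF XY])
    fix a
    assume a: "a \<in> A"
    let ?X = "X - {a} \<union> ({a} - X)"
    have "\<Phi> (?X, Y) \<le> \<Phi> (X, Y)"
      using XY a by (intro max) auto
    moreover have "switched M ?X Y x y \<longleftrightarrow> switched M X Y x y \<noteq> (x = a)" for x y
      by (auto simp: switched_def)
    ultimately show "card B \<le> 2 * card {b \<in> B. switched M X Y a b}"
      using fin a by (intro half_related_if_complementing_row_not_better) (simp_all add: \<Phi>_def)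
  next
    fix b
    assume b: "b \<in> B"
    let ?Y = "Y - {b} \<union> ({b} - Y)"
    have "\<Phi> (X, ?Y) \<le> \<Phi> (X, Y)"
      using XY b by (intro max) auto
    moreover have "switched M X ?Y x y \<longleftrightarrow> switched M X Y x y \<noteq> (y = b)" for x y
      by (auto simp: switched_def)
    ultimately show "card A \<le> 2 * card {a \<in> A. switched M X Y a b}"
      using fin b by (intro half_related_if_complementing_row_not_better) (simp_all add: \<Phi>_columns)
  qed
qed


section \<open>Connectivity and separations\<close>

definition separation :: "'a set \<Rightarrow> ('a \<times> 'a) set \<Rightarrow> 'a set \<Rightarrow> 'a set \<Rightarrow> bool" where
  "separation V A P Q \<longleftrightarrow>
    P \<noteq> {} \<and> Q \<noteq> {} \<and> P \<inter> Q = {} \<and> P \<union> Q \<subseteq> V \<and> A \<inter> Q \<times> P = {}"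

lemma separation_converse: "separation V A P Q \<Longrightarrow> separation V (A\<inverse>) Q P"
  unfolding separation_def by auto

lemma strongly_connected_iff_no_separation:
  "strongly_connected V A \<longleftrightarrow> (\<forall>P Q. P \<union> Q = V \<longrightarrow> \<not> separation V A P Q)"
proof (intro iffI allI impI notI)
  fix P Q
  assume conn: "strongly_connected V A" and PQ: "P \<union> Q = V" and sep: "separation V A P Q"
  obtain p q where p: "p \<in> P" and q: "q \<in> Q"
    using sep by (auto simp: separation_def)
  have "(A \<inter> V \<times> V)\<^sup>* `` Q = Q"
    using sep PQ by (intro Image_closed_trancl) (auto simp: separation_def)
  moreover have "(q, p) \<in> (A \<inter> V \<times> V)\<^sup>*"
    using conn p q PQ by (auto simp: strongly_connected_def)
  ultimately show False
    using p q sep by (auto simp: separation_def)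
next
  assume no_sep: "\<forall>P Q. P \<union> Q = V \<longrightarrow> \<not> separation V A P Q"
  let ?R = "(A \<inter> V \<times> V)\<^sup>*"
  show "strongly_connected V A"
    unfolding strongly_connected_def
  proof (intro ballI, rule ccontr)
    fix u v
    assume uv: "u \<in> V" "v \<in> V" "(u, v) \<notin> ?R"
    define Q where "Q = V \<inter> ?R `` {u}"
    have "A \<inter> Q \<times> (V - Q) = {}"
      by (auto simp: Q_def intro: rtrancl_into_rtrancl)
    then have "separation V A (V - Q) Q"
      using uv by (auto simp: separation_def Q_def)
    then show False
      using no_sep by (auto simp: Q_def)
  qed
qed

lemma vertex_strong_iff_separation:
  "vertex_strong V A k \<longleftrightarrow>
    k < card V \<and> (\<forall>P Q. separation V A P Q \<longrightarrow> k \<le> card (V - (P \<union> Q)))"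
proof (intro iffI conjI allI impI)
  fix P Q
  assume strong: "vertex_strong V A k" and sep: "separation V A P Q"
  show "k \<le> card (V - (P \<union> Q))"
  proof (rule ccontr)
    define S where "S = V - (P \<union> Q)"
    assume "\<not> ?thesis"
    then have "strongly_connected (V - S) (A \<inter> (V - S) \<times> (V - S))"
      using strong unfolding vertex_strong_def S_def by auto
    moreover have "P \<union> Q = V - S" "separation (V - S) (A \<inter> (V - S) \<times> (V - S)) P Q"
      using sep by (auto simp: S_def separation_def)
    ultimately show False
      unfolding strongly_connected_iff_no_separation by blast
  qed
next
  assume sep: "k < card V \<and> (\<forall>P Q. separation V A P Q \<longrightarrow> k \<le> card (V - (P \<union> Q)))"
  have "strongly_connected (V - S) (A \<inter> (V - S) \<times> (V - S))" if S: "S \<subseteq> V" "card S < k" for S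
    unfolding strongly_connected_iff_no_separation
  proof (intro allI impI notI)
    fix P Q
    assume PQ: "P \<union> Q = V - S" and "separation (V - S) (A \<inter> (V - S) \<times> (V - S)) P Q"
    then have "separation V A P Q"
      by (auto simp: separation_def)
    moreover have "V - (P \<union> Q) = S"
      using PQ S(1) by auto
    ultimately show False
      using sep S(2) by force
  qed
  then show "vertex_strong V A k"
    using sep by (auto simp: vertex_strong_def)
qed (simp add: vertex_strong_def)

lemma card_Un_le_Suc_card_Times:
  assumes "finite A" "finite B" "A \<noteq> {}" "B \<noteq> {}"
  shows "card (A \<union> B) \<le> Suc (card (A \<times> B))"
proof -
  obtain m n where "card A = Suc m" "card B = Suc n"
    using assms by (metis card_eq_0_iff not0_implies_Suc)
  then show ?thesis
    using card_Un_le[of A B] by (simp add: card_cartesian_product)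
qed

text \<open>If fewer than \<open>k\<close> arcs cross a cut, one endpoint of each can be deleted while sparing a
  vertex on either side.\<close>

lemma vertex_strong_imp_arc_strong:
  assumes strong: "vertex_strong V A k"
  shows "arc_strong V A k"
  unfolding arc_strong_def
proof (intro allI impI, rule ccontr)
  fix V1 V2
  define F where "F = {(u, v). (u, v) \<in> A \<and> u \<in> V1 \<and> v \<in> V2}"
  assume part: "V1 \<noteq> {} \<and> V2 \<noteq> {} \<and> V1 \<inter> V2 = {} \<and> V1 \<union> V2 = V"
    and "\<not> k \<le> card {(u, v). (u, v) \<in> A \<and> u \<in> V1 \<and> v \<in> V2}"
  then have F_less: "card F < k"
    by (simp add: F_def)
  have card: "k < card V"
    using strong by (simp add: vertex_strong_def)
  then have "finite V"
    using card_ge_0_finite by force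
  then have fin: "finite V1" "finite V2"
    using part by auto
  have F_sub: "F \<subseteq> V1 \<times> V2"
    by (auto simp: F_def)
  have "F \<noteq> V1 \<times> V2"
    using card_Un_le_Suc_card_Times[OF fin] part card F_less by auto
  then obtain u v where uv: "u \<in> V1" "v \<in> V2" "(u, v) \<notin> F"
    using F_sub by auto
  define S where "S = (\<lambda>(x, y). if x = u then y else x) ` F"
  have "u \<notin> S" "v \<notin> S" "S \<subseteq> V"
    using uv F_sub part by (auto simp: S_def split: if_splits)
  moreover have "x \<in> S \<or> y \<in> S" if "(x, y) \<in> F" for x y
    using that by (force simp: S_def)
  ultimately have "separation V A (V2 - S) (V1 - S)"
    using uv part by (auto simp: separation_def F_def)
  then have "k \<le> card (V - (V2 - S \<union> (V1 - S)))"
    using strong by (simp add: vertex_strong_iff_separation)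
  also have "V - (V2 - S \<union> (V1 - S)) = S"
    using part \<open>S \<subseteq> V\<close> by auto
  also have "card S \<le> card F"
    unfolding S_def using F_sub fin by (intro card_image_le) (meson finite_SigmaI finite_subset)
  finally show False
    using F_less by simp
qed


section \<open>Tournaments and inversions\<close>

lemma in_invert_iff:
  "(u, v) \<in> invert A X \<longleftrightarrow> (if u \<in> X \<and> v \<in> X then (v, u) \<in> A else (u, v) \<in> A)"
  by (auto simp: invert_def)

lemma tournamentD:
  assumes "tournament V A"
  shows "finite V" "(u, v) \<in> A \<Longrightarrow> u \<in> V \<and> v \<in> V" "(v, v) \<notin> A"
    "u \<in> V \<Longrightarrow> v \<in> V \<Longrightarrow> u \<noteq> v \<Longrightarrow> (u, v) \<in> A \<longleftrightarrow> (v, u) \<notin> A"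
  using assms unfolding tournament_def by blast+

lemma tournament_invert:
  assumes "tournament V A"
  shows "tournament V (invert A X)"
  unfolding tournament_def
proof (intro conjI ballI allI impI)
  show "finite V" using tournamentD(1)[OF assms] .
  show "invert A X \<subseteq> V \<times> V" using tournamentD(2)[OF assms] unfolding invert_def by blast
  show "(v, v) \<notin> invert A X" for v using tournamentD(3)[OF assms] by (simp add: in_invert_iff)
  show "(u, v) \<in> invert A X \<longleftrightarrow> (v, u) \<notin> invert A X" if "u \<in> V" "v \<in> V" "u \<noteq> v" for u v
    using tournamentD(4)[OF assms that] by (simp add: in_invert_iff)
qed

lemma tournament_converse: "tournament V A \<Longrightarrow> tournament V (A\<inverse>)"
  unfolding tournament_def by blast


section \<open>Separations after rewiring the ends of a median order\<close>

text \<open>Between \<open>As\<close> and \<open>Bs\<close> the tournament \<open>T'\<close> is arbitrary except for the degree conditions; its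
  arcs inside \<open>As\<close> and inside \<open>Bs\<close> never matter.\<close>

locale rewired_median_order =
  fixes V :: "'a set" and T T' :: "('a \<times> 'a) set" and As Zs Bs :: "'a list" and k :: nat
  assumes tournament: "tournament V T" and tournament': "tournament V T'"
    and vertices: "V = set (As @ Zs @ Bs)" and distinct: "distinct (As @ Zs @ Bs)"
    and median: "median_order T (As @ Zs @ Bs)"
    and agree: "u \<in> set Zs \<or> v \<in> set Zs \<Longrightarrow> (u, v) \<in> T' \<longleftrightarrow> (u, v) \<in> T"
    and length_As: "length As = 2 * k - 1" and length_Bs: "length Bs = 2 * k - 1"
    and out_degree: "b \<in> set Bs \<Longrightarrow> k \<le> count_in (T' `` {b}) As"
    and in_degree: "a \<in> set As \<Longrightarrow> k \<le> count_in (T'\<inverse> `` {a}) Bs"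
begin

lemma reverse: "rewired_median_order V (T\<inverse>) (T'\<inverse>) (rev Bs) (rev Zs) (rev As) k"
proof
  show "tournament V (T\<inverse>)" "tournament V (T'\<inverse>)"
    using tournament tournament' by (simp_all add: tournament_converse)
  show "median_order (T\<inverse>) (rev Bs @ rev Zs @ rev As)"
    using median_order_rev[OF median] by simp
  show "(u, v) \<in> T'\<inverse> \<longleftrightarrow> (u, v) \<in> T\<inverse>" if "u \<in> set (rev Zs) \<or> v \<in> set (rev Zs)" for u v
    using agree[of v u] that by auto
qed (use vertices distinct length_As length_Bs out_degree in_degree in auto)

end

locale separated_rewired_median_order = rewired_median_order +
  fixes P Q :: "'a set"
  assumes sep: "separation V T' P Q"
begin

abbreviation S :: "'a set" where
  "S \<equiv> V - (P \<union> Q)"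

lemma out_neighbour_Q: "q \<in> Q \<Longrightarrow> (q, v) \<in> T' \<Longrightarrow> v \<in> Q \<union> S"
  using sep tournamentD(2)[OF tournament'] by (auto simp: separation_def)

lemma P_dominates_Q:
  assumes "p \<in> P" "q \<in> Q" "p \<in> set Zs \<or> q \<in> set Zs"
  shows "(p, q) \<in> T - T\<inverse>"
proof -
  have T': "(q, p) \<notin> T'" and pq: "p \<noteq> q" "p \<in> V" "q \<in> V"
    using assms sep by (auto simp: separation_def)
  have "(q, p) \<notin> T"
    using T' agree assms(3) by blast
  then show ?thesis
    using tournamentD(4)[OF tournament, of p q] pq by auto
qed

lemma count_in_S: "count_in S As + count_in S Zs + count_in S Bs = card S"
proof -
  have "count_in S As + count_in S Zs + count_in S Bs = count_in S (As @ Zs @ Bs)"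
    by simp
  also have "\<dots> = card S"
    unfolding count_in_eq_card[OF distinct] vertices by (intro arg_cong[where f = card]) auto
  finally show ?thesis by simp
qed

lemma count_P_prefix_le:
  assumes As: "As = xs @ a # ys" and a: "a \<in> Q" and Zs: "Zs = us @ vs"
  shows "count_in P us \<le> count_in Q us + count_in S us + length ys"
proof -
  have "count_in (T\<inverse> `` {a}) (ys @ us) \<le> count_in (T `` {a}) (ys @ us)"
    using median As Zs by (intro median_order_in_le_out[of T xs _ _ "vs @ Bs"]) simp
  moreover have "count_in P us \<le> count_in (T\<inverse> `` {a}) us"
    using P_dominates_Q a Zs by (intro count_in_mono) auto
  moreover have "count_in (T `` {a}) us \<le> count_in (Q \<union> S) us"
    using out_neighbour_Q[OF a] agree Zs by (intro count_in_mono) auto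
  moreover have "count_in (Q \<union> S) us \<le> count_in Q us + count_in S us"
    by (rule count_in_Un_le)
  moreover have "count_in (T `` {a}) ys \<le> length ys"
    by (rule count_in_le_length)
  ultimately show ?thesis
    unfolding count_in_simps by linarith
qed

lemma Q_meets_Bs_if_meets_Zs:
  assumes small: "card S < k" and meets: "Q \<inter> set Zs \<noteq> {}"
  shows "Q \<inter> set Bs \<noteq> {}"
proof
  assume no_Bs: "Q \<inter> set Bs = {}"
  obtain xs z ys where Zs: "Zs = xs @ z # ys" and z: "z \<in> Q" and last: "\<forall>y\<in>set ys. y \<notin> Q"
    using meets split_list_last_prop[of Zs "\<lambda>z. z \<in> Q"] by blast
  have "set (ys @ Bs) \<subseteq> T\<inverse> `` {z} \<union> T `` {z}"
  proof
    fix y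
    assume "y \<in> set (ys @ Bs)"
    then show "y \<in> T\<inverse> `` {z} \<union> T `` {z}"
      using tournamentD(4)[OF tournament, of y z] vertices distinct Zs by auto
  qed
  then have "length (ys @ Bs) \<le> count_in (T\<inverse> `` {z}) (ys @ Bs) + count_in (T `` {z}) (ys @ Bs)"
    by (rule length_le_count_in_Un)
  moreover have "count_in (T\<inverse> `` {z}) (ys @ Bs) \<le> count_in (T `` {z}) (ys @ Bs)"
    using median Zs by (intro median_order_in_le_out[of T "As @ xs" _ _ "[]"]) simp
  moreover have "count_in (T `` {z}) (ys @ Bs) \<le> count_in S (ys @ Bs)"
    using out_neighbour_Q[OF z] agree[of z] Zs last no_Bs by (intro count_in_mono) auto
  moreover have "count_in S (ys @ Bs) \<le> card S"
    using count_in_S Zs by simp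
  ultimately show False
    using small length_Bs by simp
qed

lemma Q_meets_Bs:
  assumes small: "card S < k" and long: "4 * k \<le> length Zs"
  shows "Q \<inter> set Bs \<noteq> {}"
proof (cases "Q \<inter> set Zs = {}")
  case False
  with small show ?thesis by (rule Q_meets_Bs_if_meets_Zs)
next
  case no_Zs: True
  show ?thesis
  proof
    assume "Q \<inter> set Bs = {}"
    then have "Q \<inter> set As \<noteq> {}"
      using no_Zs sep vertices by (auto simp: separation_def)
    then obtain xs a ys where As: "As = xs @ a # ys" and a: "a \<in> Q"
      by (meson Int_emptyI split_list)
    have "count_in P Zs \<le> count_in Q Zs + count_in S Zs + length ys"
      using As a by (rule count_P_prefix_le) simp
    moreover have "count_in Q Zs = 0"
      using no_Zs by (rule count_in_eq_0)
    moreover have "length Zs \<le> count_in P Zs + count_in S Zs"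
      using no_Zs vertices by (intro length_le_count_in_Un) auto
    ultimately show False
      using small long length_As As count_in_S by simp
  qed
qed

lemma ex_prefix_bound:
  assumes small: "card S < k" and long: "4 * k \<le> length Zs"
  obtains c where "c < k + count_in S As"
    "\<And>us vs. Zs = us @ vs \<Longrightarrow> count_in P us \<le> count_in Q us + count_in S us + c"
proof -
  obtain b where b: "b \<in> Q" "b \<in> set Bs"
    using Q_meets_Bs[OF small long] by blast
  have "k \<le> count_in (T' `` {b}) As"
    using b(2) by (rule out_degree)
  also have "\<dots> \<le> count_in (Q \<union> S) As"
    using out_neighbour_Q[OF b(1)] by (intro count_in_mono) auto
  also have "\<dots> \<le> count_in Q As + count_in S As"
    by (rule count_in_Un_le)
  finally have Q_As: "k \<le> count_in Q As + count_in S As" .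
  have "Q \<inter> set As \<noteq> {}"
  proof
    assume "Q \<inter> set As = {}"
    then have "count_in Q As = 0"
      by (rule count_in_eq_0)
    then show False
      using Q_As small count_in_S by simp
  qed
  then obtain xs a ys where As: "As = xs @ a # ys" and a: "a \<in> Q" and last: "\<forall>y\<in>set ys. y \<notin> Q"
    using split_list_last_prop[of As "\<lambda>z. z \<in> Q"] by blast
  have "count_in Q ys = 0"
    using last by (intro count_in_eq_0) auto
  then have "count_in Q As \<le> length xs + 1"
    using As a count_in_le_length[of Q xs] by simp
  then have "length ys < k + count_in S As"
    using Q_As small length_As As by simp
  then show thesis
    using that count_P_prefix_le[OF As a] by blast
qed

lemma length_Zs_less:
  assumes small: "card S < k"
  shows "length Zs < 7 * k"
proof (cases "4 * k \<le> length Zs")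
  case long: True
  interpret rev: rewired_median_order V "T\<inverse>" "T'\<inverse>" "rev Bs" "rev Zs" "rev As" k
    by (rule reverse)
  interpret rev: separated_rewired_median_order V "T\<inverse>" "T'\<inverse>" "rev Bs" "rev Zs" "rev As" k Q P
    by unfold_locales (rule separation_converse[OF sep])
  have rev_S: "V - (Q \<union> P) = S"
    by auto
  obtain c where c: "c < k + count_in S As"
    and prefix: "\<And>us vs. Zs = us @ vs \<Longrightarrow> count_in P us \<le> count_in Q us + count_in S us + c"
    using ex_prefix_bound[OF small long] by blast
  obtain d where d: "d < k + count_in S Bs"
    and rev_prefix: "\<And>us vs. rev Zs = us @ vs \<Longrightarrow>
      count_in Q us \<le> count_in P us + count_in S us + d"
    using rev.ex_prefix_bound small long unfolding rev_S by auto
  have suffix: "count_in Q vs \<le> count_in P vs + count_in S vs + d" if "Zs = us @ vs" for us vs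
    using rev_prefix[of "rev vs" "rev us"] that by simp
  have "length Zs \<le> 5 * count_in S Zs + c + d"
  proof (rule median_order_length_le[where P = P and Q = Q and T = T])
    show "median_order T Zs"
      using median by (rule median_order_infix)
    show "(P \<inter> set Zs) \<times> (Q \<inter> set Zs) \<subseteq> T - T\<inverse>"
      using P_dominates_Q by auto
  qed (use distinct vertices sep prefix suffix in \<open>auto simp: separation_def\<close>)
  then show ?thesis
    using c d small count_in_S by linarith
qed simp

end

lemma (in rewired_median_order) vertex_strong:
  assumes "k \<ge> 1" and long: "7 * k \<le> length Zs"
  shows "vertex_strong V T' k"
  unfolding vertex_strong_iff_separation
proof (intro conjI allI impI)
  have "card V = length (As @ Zs @ Bs)"
    unfolding vertices using distinct by (rule distinct_card)
  with assms show "k < card V"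
    by simp
  fix P Q
  assume "separation V T' P Q"
  then interpret separated_rewired_median_order V T T' As Zs Bs k P Q
    by unfold_locales
  show "k \<le> card (V - (P \<union> Q))"
    using length_Zs_less long by linarith
qed


section \<open>Two inversions suffice\<close>

lemma invert_twice_outside:
  assumes "A' \<subseteq> A" "B' \<subseteq> B" "u \<notin> A \<union> B \<or> v \<notin> A \<union> B"
  shows "(u, v) \<in> invert (invert T (A' \<union> B)) (A \<union> B') \<longleftrightarrow> (u, v) \<in> T"
proof -
  have "\<not> (u \<in> A' \<union> B \<and> v \<in> A' \<union> B)" "\<not> (u \<in> A \<union> B' \<and> v \<in> A \<union> B')"
    using assms by blast+
  then show ?thesis
    by (simp only: in_invert_iff if_False)
qed

lemma invert_twice_between:
  assumes "A \<inter> B = {}" "A' \<subseteq> A" "B' \<subseteq> B" "a \<in> A" "b \<in> B"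
  shows "(b, a) \<in> invert (invert T (A' \<union> B)) (A \<union> B') \<longleftrightarrow>
    (if (a \<in> A') \<noteq> (b \<in> B') then (a, b) \<in> T else (b, a) \<in> T)"
proof -
  have "a \<notin> B" "b \<notin> A" "a \<notin> B'" "b \<notin> A'"
    using assms by blast+
  then show ?thesis
    using assms(4,5) by (simp add: in_invert_iff)
qed

lemma ex_two_inversions_balanced:
  assumes tour: "tournament V T" and sub: "A \<subseteq> V" "B \<subseteq> V" and disj: "A \<inter> B = {}"
  obtains X Y where "X \<subseteq> V" "Y \<subseteq> V" "tournament V (invert_seq T [X, Y])"
    "\<And>u v. u \<notin> A \<union> B \<or> v \<notin> A \<union> B \<Longrightarrow> (u, v) \<in> invert_seq T [X, Y] \<longleftrightarrow> (u, v) \<in> T"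
    "\<And>a. a \<in> A \<Longrightarrow> card B \<le> 2 * card ((invert_seq T [X, Y])\<inverse> `` {a} \<inter> B)"
    "\<And>b. b \<in> B \<Longrightarrow> card A \<le> 2 * card (invert_seq T [X, Y] `` {b} \<inter> A)"
proof -
  have "finite A" "finite B"
    using tournamentD(1)[OF tour] sub by (auto intro: finite_subset)
  then obtain A' B' where sub': "A' \<subseteq> A" "B' \<subseteq> B"
    and rows: "\<And>a. a \<in> A \<Longrightarrow> card B \<le> 2 * card {b \<in> B. switched (\<lambda>a b. (b, a) \<in> T) A' B' a b}"
    and columns: "\<And>b. b \<in> B \<Longrightarrow> card A \<le> 2 * card {a \<in> A. switched (\<lambda>a b. (b, a) \<in> T) A' B' a b}"
    using ex_balanced_switching[of A B "\<lambda>a b. (b, a) \<in> T"] by auto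
  define T' where "T' = invert_seq T [A' \<union> B, A \<union> B']"
  have T': "T' = invert (invert T (A' \<union> B)) (A \<union> B')"
    by (simp add: T'_def invert_seq_def)
  have between: "(b, a) \<in> T' \<longleftrightarrow> switched (\<lambda>a b. (b, a) \<in> T) A' B' a b" if "a \<in> A" "b \<in> B" for a b
  proof -
    have "(a, b) \<in> T \<longleftrightarrow> (b, a) \<notin> T"
      using that sub disj by (intro tournamentD(4)[OF tour]) auto
    then show ?thesis
      unfolding T' invert_twice_between[OF disj sub' that] by (auto simp: switched_def)
  qed
  have in_B: "T'\<inverse> `` {a} \<inter> B = {b \<in> B. switched (\<lambda>a b. (b, a) \<in> T) A' B' a b}" if "a \<in> A" for a
    using between[OF that] by auto
  have out_A: "T' `` {b} \<inter> A = {a \<in> A. switched (\<lambda>a b. (b, a) \<in> T) A' B' a b}" if "b \<in> B" for b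
    using between[OF _ that] by auto
  show thesis
  proof (rule that[of "A' \<union> B" "A \<union> B'", folded T'_def])
    show "A' \<union> B \<subseteq> V" "A \<union> B' \<subseteq> V"
      using sub sub' by auto
    show "tournament V T'"
      unfolding T' using tour by (intro tournament_invert)
    show "(u, v) \<in> T' \<longleftrightarrow> (u, v) \<in> T" if "u \<notin> A \<union> B \<or> v \<notin> A \<union> B" for u v
      unfolding T' using sub' that by (rule invert_twice_outside)
  qed (simp_all add: rows columns in_B out_A)
qed

lemma split_list_ends:
  assumes "2 * m \<le> length xs"
  obtains As Zs Bs where "xs = As @ Zs @ Bs" "length As = m" "length Bs = m"
proof
  let ?n = "length xs - 2 * m"
  show "xs = take m xs @ take ?n (drop m xs) @ drop ?n (drop m xs)"
    by (metis append_take_drop_id)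
qed (use assms in simp_all)

lemma two_inversions_vertex_strong:
  assumes tour: "tournament V T" and k: "k \<ge> 1" and card: "11 * k - 2 \<le> card V"
  obtains X Y where "X \<subseteq> V" "Y \<subseteq> V" "vertex_strong V (invert_seq T [X, Y]) k"
proof -
  obtain vs where vs: "set vs = V" "distinct vs" "median_order T vs"
    using tournamentD(1)[OF tour] by (rule ex_median_order)
  have "length vs = card V"
    using vs by (metis distinct_card)
  then have "2 * (2 * k - 1) \<le> length vs"
    using card k by linarith
  then obtain As Zs Bs where split: "vs = As @ Zs @ Bs"
    and len: "length As = 2 * k - 1" "length Bs = 2 * k - 1"
    by (rule split_list_ends)
  have "set As \<subseteq> V" "set Bs \<subseteq> V" "set As \<inter> set Bs = {}"
    using vs split by auto
  with tour obtain X Y where XY: "X \<subseteq> V" "Y \<subseteq> V"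
    and tour': "tournament V (invert_seq T [X, Y])"
    and outside: "\<And>u v. u \<notin> set As \<union> set Bs \<or> v \<notin> set As \<union> set Bs \<Longrightarrow>
      (u, v) \<in> invert_seq T [X, Y] \<longleftrightarrow> (u, v) \<in> T"
    and in_half: "\<And>a. a \<in> set As \<Longrightarrow>
      card (set Bs) \<le> 2 * card ((invert_seq T [X, Y])\<inverse> `` {a} \<inter> set Bs)"
    and out_half: "\<And>b. b \<in> set Bs \<Longrightarrow>
      card (set As) \<le> 2 * card (invert_seq T [X, Y] `` {b} \<inter> set As)"
    by (rule ex_two_inversions_balanced) (rule that)
  have dist: "distinct As" "distinct Bs"
    using vs split by simp_all
  interpret rewired_median_order V T "invert_seq T [X, Y]" As Zs Bs k
  proof
    show "k \<le> count_in (invert_seq T [X, Y] `` {b}) As" if "b \<in> set Bs" for b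
      using out_half[OF that] dist len by (simp add: count_in_eq_card distinct_card)
    show "k \<le> count_in ((invert_seq T [X, Y])\<inverse> `` {a}) Bs" if "a \<in> set As" for a
      using in_half[OF that] dist len by (simp add: count_in_eq_card distinct_card)
    show "(u, v) \<in> invert_seq T [X, Y] \<longleftrightarrow> (u, v) \<in> T" if "u \<in> set Zs \<or> v \<in> set Zs" for u v
      using vs split that by (intro outside) auto
  qed (use vs tour tour' len split in simp_all)
  have "7 * k \<le> length Zs"
    using \<open>length vs = card V\<close> card k len split by simp
  with XY k show thesis
    using that vertex_strong by blast
qed


section \<open>The inversion numbers\<close>

lemma sinv'_le_sinv: "sinv' V A k \<le> sinv V A k"
  unfolding sinv_def sinv'_def
  by (rule Inf_superset_mono) (auto intro: vertex_strong_imp_arc_strong)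

lemma m'_k_le_m_k: "m'_k k n \<le> m_k k n"
  unfolding m_k_def m'_k_def by (rule Sup_mono) (use sinv'_le_sinv in blast)

lemma sinv_le_2:
  assumes "tournament V T" "k \<ge> 1" "11 * k - 2 \<le> card V"
  shows "sinv V T k \<le> 2"
proof -
  obtain X Y where "X \<subseteq> V" "Y \<subseteq> V" "vertex_strong V (invert_seq T [X, Y]) k"
    using two_inversions_vertex_strong[OF assms] .
  then have "sinv V T k \<le> enat (length [X, Y])"
    unfolding sinv_def by (intro Inf_lower) (auto intro!: exI[of _ "[X, Y]"])
  then show ?thesis
    by (simp add: numeral_eq_enat numeral_2_eq_2)
qed

lemma m_k_le_2:
  assumes "k \<ge> 1" "11 * k - 2 \<le> n"
  shows "m_k k n \<le> 2"
  unfolding m_k_def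
proof (rule Sup_least)
  fix x
  assume "x \<in> {sinv {0..<n} A k |A. tournament {0..<n} A}"
  then obtain A where "x = sinv {0..<n} A k" "tournament {0..<n} A"
    by blast
  then show "x \<le> 2"
    using sinv_le_2[of "{0..<n}" A k] assms by simp
qed

lemma N_k_le:
  assumes "\<And>n. M \<le> n \<Longrightarrow> m_k k n \<le> enat i"
  shows "N_k k i \<le> M"
  unfolding N_k_def using assms by (intro Least_le) simp

text \<open>Without the hypothesis, \<open>N_k k i\<close> could be a least element of the empty set.\<close>

lemma N'_k_le_N_k:
  assumes "\<And>n. M \<le> n \<Longrightarrow> m_k k n \<le> enat i"
  shows "N'_k k i \<le> N_k k i"
proof -
  let ?bound = "\<lambda>N. \<forall>n\<ge>N. n \<ge> 2 * k + 1 \<longrightarrow> m_k k n \<le> enat i"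
  have "?bound M"
    using assms by blast
  then have "?bound (N_k k i)"
    unfolding N_k_def by (rule LeastI[of ?bound])
  then show ?thesis
    unfolding N'_k_def by (intro Least_le) (meson m'_k_le_m_k order_trans)
qed

theorem theorem1p14:
  fixes k :: nat
  assumes "k \<ge> 1"
  shows "N'_k k 3 \<le> N_k k 3 \<and> N_k k 3 \<le> 11 * k - 2 \<and>
    (\<forall>(V :: 'a set) A. tournament V A \<and> card V \<ge> 11 * k - 2 \<longrightarrow>
        sinv' V A k \<le> sinv V A k \<and> sinv V A k \<le> 3)"
proof (intro conjI allI impI)
  have le_3: "x \<le> 3" if "x \<le> 2" for x :: enat
    using that by (rule order_trans) (simp add: numeral_eq_enat)
  have m_k_le_3: "m_k k n \<le> enat 3" if "11 * k - 2 \<le> n" for n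
    using le_3[OF m_k_le_2[OF assms that]] by (simp add: numeral_eq_enat)
  show "N'_k k 3 \<le> N_k k 3"
    using m_k_le_3 by (rule N'_k_le_N_k)
  show "N_k k 3 \<le> 11 * k - 2"
    using m_k_le_3 by (rule N_k_le)
  fix V :: "'a set" and A
  assume A: "tournament V A \<and> card V \<ge> 11 * k - 2"
  show "sinv' V A k \<le> sinv V A k"
    by (rule sinv'_le_sinv)
  show "sinv V A k \<le> 3"
    using A assms by (intro le_3 sinv_le_2) simp_all
qed

end
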